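(* Let $\mathbb{F}$ be a field, let $V$ be a vector space over $\mathbb{F}$ with countable dimension, and let $u$ be a locally nilpotent endomorphism of $V$. Then $\mathrm{id}_V+u$ is the product of two involutions of $V$, and it is also the product of two unipotent endomorphisms of $V$ of index $2$.
   Context: "Countable" includes finite. An endomorphism $u$ of $V$ is locally nilpotent if for every $x\in V$ there is $n\in\mathbb{N}$ with $u^n(x)=0$. An involution of $V$ is an endomorphism $a$ with $a^2=\mathrm{id}_V$. A unipotent endomorphism of index $2$ is an endomorphism $a$ with $(a-\mathrm{id}_V)^2=0$ (so $a=\mathrm{id}_V$ is allowed). *)

theory Defs
  imports Complex_Main "HOL-Library.Countable_Set"
begin

text \<open>The vector space \<open>V\<close> is the whole type \<open>'v\<close>, with scalar multiplication \<open>scale\<close> over the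
  field \<open>'f\<close>. The library's \<open>dim\<close> is a natural number that is \<open>0\<close> in infinite dimension, so
  countable dimension is expressed through a basis. Note that \<open>countable\<close> includes finite.\<close>

definition countable_dimension :: "('f::field \<Rightarrow> 'v::ab_group_add \<Rightarrow> 'v) \<Rightarrow> bool"
  where "countable_dimension scale \<longleftrightarrow>
    (\<exists>B. countable B \<and> \<not> module.dependent scale B \<and> module.span scale B = UNIV)"

abbreviation endomorphism :: "('f::field \<Rightarrow> 'v::ab_group_add \<Rightarrow> 'v) \<Rightarrow> ('v \<Rightarrow> 'v) \<Rightarrow> bool"
  where "endomorphism scale a \<equiv> Vector_Spaces.linear scale scale a"

definition locally_nilpotent :: "('v::ab_group_add \<Rightarrow> 'v) \<Rightarrow> bool"
  where "locally_nilpotent u \<longleftrightarrow> (\<forall>x. \<exists>n::nat. (u ^^ n) x = 0)"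

definition involution :: "('f::field \<Rightarrow> 'v::ab_group_add \<Rightarrow> 'v) \<Rightarrow> ('v \<Rightarrow> 'v) \<Rightarrow> bool"
  where "involution scale a \<longleftrightarrow> endomorphism scale a \<and> a ^^ 2 = id"

definition unipotent_index_2 :: "('f::field \<Rightarrow> 'v::ab_group_add \<Rightarrow> 'v) \<Rightarrow> ('v \<Rightarrow> 'v) \<Rightarrow> bool"
  where "unipotent_index_2 scale a \<longleftrightarrow>
    endomorphism scale a \<and> (\<lambda>x. a x - id x) ^^ 2 = (\<lambda>x. 0)"

end

theory Submission
  imports Defs
begin

text \<open>
  The core is that \<open>V\<close> has a basis graded by natural numbers for which \<open>u\<close> has degree \<open>-1\<close>. Such a
  basis is the union of a chain of finite graded independent sets. To be able to continue beyond a
  finite stage with span \<open>S\<close>, one keeps \<open>S \<inter> D\<close> homogeneous for every \<open>D\<close> in the transfinite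
  chain of iterated images of \<open>u\<close>; this plays the role of height preservation in the back-and-forth
  proof of Ulm's theorem, with heights replaced by membership in the members of the chain.

  Write \<open>g = id + u\<close>. Graded bases reduce the claim to a single Jordan block, where \<open>u\<close> is
  multiplication by \<open>t\<close> on Laurent series modulo \<open>t F[[t]]\<close>. The involution is
  induced by the substitution \<open>t \<mapsto> (1 + t)\<^sup>-\<^sup>1 - 1\<close>, which conjugates \<open>g\<close> to its inverse.
  The unipotent factors come from \<open>[[1,1],[0,1]] [[1,0],[s,1]]\<close>, the matrix of \<open>1 + t\<close> in the basis
  \<open>t, 1\<close> over Laurent series in \<open>s = t\<^sup>2 / (1 + t)\<close>.
\<close>

section \<open>Chains of subspaces\<close>

text \<open>Reverse inclusion is chain complete, so \<open>ccpo.iterates\<close> provides decreasing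
  transfinite iteration without ordinals.\<close>

lemma ccpo_Inter: "class.ccpo Inter (\<lambda>A B. B \<subseteq> A) (\<lambda>A B. B \<subset> A)"
  by unfold_locales auto

context vector_space
begin

lemma finite_dim_subspace_eq:
  assumes "finite F" "subspace P" "P \<subseteq> Q" "Q \<subseteq> span F" "dim Q \<le> dim P"
  shows "P = Q"
proof -
  obtain A where A: "A \<subseteq> P" "independent A" "P \<subseteq> span A"
    using maximal_independent_subset[of P] by blast
  obtain A' where A': "A \<subseteq> A'" "A' \<subseteq> Q" "independent A'" "Q \<subseteq> span A'"
    using maximal_independent_subset_extend[of A Q] A assms(3) by blast
  have fin: "finite A'"
    using independent_span_bound[of F A'] A' assms(1,4) by blast
  have "card A = dim P" "card A' = dim Q"
    using basis_card_eq_dim[of A P] basis_card_eq_dim[of A' Q] A A' by auto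
  then have "A = A'"
    using card_seteq[OF fin A'(1)] assms(5) by simp
  then have "Q \<subseteq> P"
    using A'(4) span_minimal[OF A(1) assms(2)] by blast
  then show ?thesis using assms(3) by blast
qed

text \<open>Minimizing \<open>dim (D \<inter> T)\<close> replaces well-foundedness of inclusion:
  below the minimizer the trace on \<open>T\<close> can only shrink, yet its dimension cannot
  drop.\<close>

lemma minimal_trace:
  assumes "X \<noteq> {}" "\<And>D. D \<in> X \<Longrightarrow> subspace D" "subspace T" "T \<subseteq> span F" "finite F"
  obtains D where "D \<in> X" "\<And>E. E \<in> X \<Longrightarrow> E \<subseteq> D \<Longrightarrow> E \<inter> T = D \<inter> T"
proof -
  from assms(1) obtain D0 where "D0 \<in> X" by blast
  then obtain D where D: "D \<in> X" "\<And>E. E \<in> X \<Longrightarrow> dim (D \<inter> T) \<le> dim (E \<inter> T)"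
    using ex_has_least_nat[of "\<lambda>D. D \<in> X" D0 "\<lambda>D. dim (D \<inter> T)"] by blast
  show thesis
  proof (rule that[OF D(1)])
    fix E assume "E \<in> X" "E \<subseteq> D"
    then show "E \<inter> T = D \<inter> T"
      using finite_dim_subspace_eq[OF assms(5), of "E \<inter> T" "D \<inter> T"] D(2) assms(2-4) subspace_inter
      by blast
  qed
qed

text \<open>Any point \<open>x + w\<close> of the coset in a member \<open>D\<close> of minimal
  trace will do: if a smaller \<open>E\<close> contains \<open>x + w'\<close>, then
  \<open>w - w'\<close> lies in \<open>D \<inter> T = E \<inter> T\<close>, so \<open>x + w\<close>
  is in \<open>E\<close> too.\<close>

lemma deepest_in_coset:
  assumes "\<And>D. D \<in> X \<Longrightarrow> subspace D" "\<And>D E. D \<in> X \<Longrightarrow> E \<in> X \<Longrightarrow> D \<subseteq> E \<or> E \<subseteq> D"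
    and T: "subspace T" "T \<subseteq> span F" "finite F"
  obtains w where "w \<in> T" "\<And>E w'. E \<in> X \<Longrightarrow> w' \<in> T \<Longrightarrow> x + w' \<in> E \<Longrightarrow> x + w \<in> E"
proof (cases "\<exists>E\<in>X. \<exists>w\<in>T. x + w \<in> E")
  case False
  then show thesis using that[of 0] subspace_0[OF T(1)] by blast
next
  case True
  let ?X = "{E \<in> X. \<exists>w\<in>T. x + w \<in> E}"
  obtain D where D: "D \<in> ?X" "\<And>E. E \<in> ?X \<Longrightarrow> E \<subseteq> D \<Longrightarrow> E \<inter> T = D \<inter> T"
    using minimal_trace[of ?X T F] True assms by blast
  then obtain w where w: "w \<in> T" "x + w \<in> D" by blast
  show thesis
  proof (rule that[OF w(1)])
    fix E w' assume E: "E \<in> X" "w' \<in> T" "x + w' \<in> E"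
    show "x + w \<in> E"
    proof (cases "D \<subseteq> E")
      case True then show ?thesis using w by blast
    next
      case False
      then have "E \<subseteq> D" using assms(2) D(1) E(1) by blast
      have "(x + w) - (x + w') \<in> D"
        using w E \<open>E \<subseteq> D\<close> D(1) assms(1) subspace_diff by blast
      moreover have "w - w' \<in> T" using w E T subspace_diff by blast
      ultimately have "w - w' \<in> E \<inter> T" using D(2)[of E] E \<open>E \<subseteq> D\<close> by auto
      then have "(x + w') + (w - w') \<in> E" using E assms(1) subspace_add by blast
      then show ?thesis by simp
    qed
  qed
qed

end

section \<open>The transfinite chain of iterated images\<close>

locale locally_nilpotent_endomorphism =
  vector_space scale + u: Vector_Spaces.linear scale scale u
  for scale :: "'f::field \<Rightarrow> 'v::ab_group_add \<Rightarrow> 'v" and u :: "'v \<Rightarrow> 'v" +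
  assumes nilpotent: "\<exists>n. (u ^^ n) x = 0"
begin

sublocale endo: vector_space_pair scale scale ..

text \<open>Under reverse inclusion, suprema are intersections; \<open>Inter {} = UNIV\<close> starts the iteration.\<close>

definition image_chain :: "'v set set"
  where "image_chain = ccpo.iterates Inter (\<lambda>A B. B \<subseteq> A) (image u)"

lemma image_chain_total:
  assumes "D \<in> image_chain" "E \<in> image_chain"
  shows "D \<subseteq> E \<or> E \<subseteq> D"
proof -
  interpret ccpo Inter "\<lambda>A B :: 'v set. B \<subseteq> A" "\<lambda>A B. B \<subset> A" by (rule ccpo_Inter)
  have "monotone (\<lambda>A B. B \<subseteq> A) (\<lambda>A B. B \<subseteq> A) (image u)" by (auto simp: monotone_def)
  from chain_iterates[OF this] show ?thesis
    using assms unfolding image_chain_def chain_def by blast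
qed

lemma image_chain_image: "D \<in> image_chain \<Longrightarrow> u ` D \<in> image_chain"
  unfolding image_chain_def by (rule ccpo.iterates.step[OF ccpo_Inter])

lemma image_chain_Inter: 
  assumes "M \<subseteq> image_chain" shows "\<Inter>M \<in> image_chain"
proof -
  have "Complete_Partial_Order.chain (\<lambda>A B. B \<subseteq> A) M"
    using assms image_chain_total unfolding Complete_Partial_Order.chain_def by blast
  then show ?thesis
    using assms unfolding image_chain_def by (intro ccpo.iterates.Sup[OF ccpo_Inter]) auto
qed

lemma image_chain_subspace: "D \<in> image_chain \<Longrightarrow> subspace D"
  unfolding image_chain_def
proof (induction rule: ccpo.iterates.induct[OF ccpo_Inter, consumes 1])
  case (1 x)
  then show ?case by (simp add: u.subspace_image)
next
  case (2 M)
  then show ?case by (intro subspace_Inter) blast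
qed

lemma deepest_in_image_chain:
  assumes "subspace T" "T \<subseteq> span F" "finite F"
  shows "\<exists>w\<in>T. \<forall>E\<in>image_chain. \<forall>w'\<in>T. x + w' \<in> E \<longrightarrow> x + w \<in> E"
  by (rule deepest_in_coset[of image_chain T F x])
    (use assms image_chain_subspace image_chain_total in blast)+

section \<open>Construction of a graded basis\<close>

definition part :: "'v set \<Rightarrow> ('v \<Rightarrow> nat) \<Rightarrow> nat \<Rightarrow> 'v \<Rightarrow> 'v"
  where "part B d i = endo.construct B (\<lambda>b. if d b = i then b else 0)"

lemma linear_part: "independent B \<Longrightarrow> Vector_Spaces.linear scale scale (part B d i)"
  unfolding part_def by (rule endo.linear_construct)

lemma part_basis: "independent B \<Longrightarrow> b \<in> B \<Longrightarrow> part B d i b = (if d b = i then b else 0)"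
  unfolding part_def by (rule endo.construct_basis)

lemma part_in_span: 
  assumes "independent B"
  shows "part B d i v \<in> span {b \<in> B. d b = i}"
proof -
  have "part B d i v \<in> span ((\<lambda>b. if d b = i then b else 0) ` B)"
    unfolding part_def by (rule endo.construct_in_span[OF assms])
  also have "\<dots> \<subseteq> span (insert 0 {b \<in> B. d b = i})" by (rule span_mono) auto
  finally show ?thesis by simp
qed

lemma part_homogeneous:
  assumes "independent B" "v \<in> span {b \<in> B. d b = i}"
  shows "part B d i v = v"
  by (rule endo.linear_eq_on[OF linear_part[OF assms(1)] linear_ident assms(2)])
    (simp add: part_basis assms(1))

lemma sum_part:
  assumes "independent B" "finite B" "v \<in> span B"
  shows "(\<Sum>i\<in>d ` B. part B d i v) = v"
  by (rule endo.linear_eq_on[OF endo.linear_compose_sum linear_ident assms(3)])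
    (auto simp: linear_part part_basis assms)

text \<open>The degree condition avoids subtraction: for \<open>d b = 0\<close> the spanning set is
  empty, which forces \<open>u b = 0\<close>.\<close>

definition graded_stage :: "'v set \<Rightarrow> ('v \<Rightarrow> nat) \<Rightarrow> bool"
  where "graded_stage B d \<longleftrightarrow> finite B \<and> independent B
    \<and> (\<forall>b\<in>B. u b \<in> span {b' \<in> B. Suc (d b') = d b})
    \<and> (\<forall>D\<in>image_chain. \<forall>v\<in>D \<inter> span B. \<forall>i. part B d i v \<in> D)"

lemma graded_stage_invariant:
  assumes "graded_stage B d" "v \<in> span B"
  shows "u v \<in> span B"
  using assms(2)
proof (induction rule: span_induct)
  case base
  show ?case using u.subspace_linear_preimage[OF subspace_span] by (simp add: Collect_mem_eq)
next
  case (step b)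
  then show ?case using assms(1) span_mono[of "{b' \<in> B. Suc (d b') = d b}" B]
    unfolding graded_stage_def by blast
qed

lemma u_part:
  assumes "graded_stage B d" "v \<in> span B"
  shows "part B d i (u v) = u (part B d (Suc i) v)"
proof -
  have ind: "independent B" and u: "\<And>b. b \<in> B \<Longrightarrow> u b \<in> span {b' \<in> B. Suc (d b') = d b}"
    using assms(1) unfolding graded_stage_def by auto
  have z: "part B d i w = 0" if "w \<in> span {b' \<in> B. Suc (d b') = j}" "j \<noteq> Suc i" for w j
    by (rule endo.linear_eq_on[OF linear_part[OF ind] endo.linear_zero that(1)])
      (use that(2) in \<open>auto simp add: part_basis ind\<close>)
  have l: "endomorphism scale (part B d i)" for i by (rule linear_part[OF ind])
  have "(part B d i \<circ> u) v = (u \<circ> part B d (Suc i)) v"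
  proof (rule endo.linear_eq_on[OF _ _ assms(2)])
    show "endomorphism scale (part B d i \<circ> u)"
      "endomorphism scale (u \<circ> part B d (Suc i))"
      using l u.linear_axioms by (auto intro: Vector_Spaces.linear_compose)
    fix b assume b: "b \<in> B"
    show "(part B d i \<circ> u) b = (u \<circ> part B d (Suc i)) b"
      using u[OF b] z[OF u[OF b]] part_homogeneous[OF ind, of "u b" d i]
      by (auto simp: part_basis ind b)
  qed
  then show ?thesis by simp
qed

text \<open>By \<open>proper\<close>, \<open>y\<close> lies as deep as any element of
  \<open>y + span B\<close>. Hence a member \<open>D\<close> containing a vector with nonzero
  \<open>y\<close>-coefficient contains \<open>y\<close> itself, and the rest of that vector is
  covered by homogeneity of the old stage.\<close>

lemma graded_stage_insert:
  assumes stage: "graded_stage B d" and y: "y \<notin> span B" and uy: "u y \<in> span {b \<in> B. Suc (d b) = j}"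
    and proper: "\<And>E w. E \<in> image_chain \<Longrightarrow> w \<in> span B \<Longrightarrow> y + w \<in> E \<Longrightarrow> y \<in> E"
  shows "graded_stage (insert y B) (d(y := j))"
proof -
  let ?B = "insert y B" and ?d = "d(y := j)"
  have ind: "independent B" and u: "\<And>b. b \<in> B \<Longrightarrow> u b \<in> span {b' \<in> B. Suc (d b') = d b}"
    and hom: "\<And>D v i. D \<in> image_chain \<Longrightarrow> v \<in> D \<Longrightarrow> v \<in> span B \<Longrightarrow> part B d i v \<in> D"
    and fin: "finite B"
    using stage unfolding graded_stage_def by auto
  have ind': "independent ?B" using independent_insertI y ind by blast
  have "y \<notin> B" using y span_base by blast
  have part_eq: "part ?B ?d i w = part B d i w" if "w \<in> span B" for i w
    by (rule endo.linear_eq_on[OF linear_part[OF ind'] linear_part[OF ind] that])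
      (use \<open>y \<notin> B\<close> in \<open>auto simp: part_basis ind ind'\<close>)
  have mono: "span {b' \<in> B. Suc (d b') = i} \<subseteq> span {b' \<in> ?B. Suc (?d b') = i}" for i
    by (rule span_mono) (use \<open>y \<notin> B\<close> in auto)
  have "part ?B ?d i v \<in> D" if D: "D \<in> image_chain" and v: "v \<in> D" "v \<in> span ?B" for D v i
  proof -
    have sub: "subspace D" using D by (rule image_chain_subspace)
    obtain c where w: "v - scale c y \<in> span B"
      using v(2) span_breakdown_eq by blast
    interpret p: Vector_Spaces.linear scale scale "part ?B ?d i" by (rule linear_part[OF ind'])
    have cy: "scale c y \<in> D"
    proof (cases "c = 0")
      case True then show ?thesis using subspace_0[OF sub] by simp
    next
      case False
      have "y + scale (inverse c) (v - scale c y) = scale (inverse c) v"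
        using False by (simp add: scale_right_diff_distrib)
      moreover have "scale (inverse c) v \<in> D" using subspace_scale[OF sub v(1)] .
      ultimately have "y \<in> D"
        using proper[OF D span_scale[OF w]] by metis
      then show ?thesis using subspace_scale[OF sub] by blast
    qed
    have "part ?B ?d i v = part ?B ?d i (v - scale c y) + scale c (part ?B ?d i y)"
      by (simp add: p.diff p.scale)
    also have "\<dots> = part B d i (v - scale c y) + scale c (if i = j then y else 0)"
      using part_eq[OF w] by (simp add: part_basis ind')
    also have "\<dots> \<in> D"
      using hom[OF D _ w] subspace_diff[OF sub v(1) cy] cy subspace_add[OF sub] subspace_0[OF sub] by auto
    finally show ?thesis .
  qed
  moreover have "\<forall>b\<in>?B. u b \<in> span {b' \<in> ?B. Suc (?d b') = ?d b}"
    using u uy mono \<open>y \<notin> B\<close> by fastforce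
  ultimately show ?thesis
    unfolding graded_stage_def using ind' fin by blast
qed

section \<open>Lifting homogeneous vectors through \<open>u\<close>\<close>

definition stage_extends :: "'v set \<Rightarrow> ('v \<Rightarrow> nat) \<Rightarrow> 'v set \<Rightarrow> ('v \<Rightarrow> nat) \<Rightarrow> bool"
  where "stage_extends B d B' d' \<longleftrightarrow> B \<subseteq> B' \<and> (\<forall>b\<in>B. d' b = d b)"

text \<open>The hypothesis on \<open>s\<close> says that it lies as deep in the images of the chain as any element of its
  coset does. The preimage is taken in a member of the chain with minimal trace on \<open>span B\<close>, which
  makes it as deep as any element of its own coset modulo \<open>span B\<close>.\<close>

lemma lift_homogeneous:
  assumes stage: "graded_stage B d" and \<beta>: "\<beta> \<in> image_chain"
    and s: "s \<in> u ` \<beta>" "s \<in> span {b \<in> B. d b = i}"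
    and deepest: "\<And>E w. E \<in> image_chain \<Longrightarrow> w \<in> \<beta> \<Longrightarrow> w \<in> span {b \<in> B. d b = Suc i} \<Longrightarrow>
      s + u w \<in> u ` E \<Longrightarrow> s \<in> u ` E"
  shows "\<exists>B' d' y. graded_stage B' d' \<and> stage_extends B d B' d' \<and> (\<forall>b\<in>B' - B. d' b = Suc i)
    \<and> B' \<subseteq> insert y B \<and> y \<in> \<beta> \<and> u y = s \<and> y \<in> span B'"
proof -
  have ind: "independent B" and fin: "finite B"
    and hom: "\<And>D v i. D \<in> image_chain \<Longrightarrow> v \<in> D \<Longrightarrow> v \<in> span B \<Longrightarrow> part B d i v \<in> D"
    using stage unfolding graded_stage_def by auto
  let ?X = "{D \<in> image_chain. D \<subseteq> \<beta> \<and> s \<in> u ` D}"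
  have ne: "?X \<noteq> {}" using \<beta> s by blast
  have sub: "subspace D" if "D \<in> ?X" for D using that image_chain_subspace by blast
  obtain D where D: "D \<in> ?X"
    and Dmin: "\<And>E. E \<in> ?X \<Longrightarrow> E \<subseteq> D \<Longrightarrow> E \<inter> span B = D \<inter> span B"
    by (rule minimal_trace[OF ne sub subspace_span order_refl fin]) (assumption, rule that)
  then obtain y where y: "y \<in> D" "u y = s" by blast
  have subD: "subspace D" using D image_chain_subspace by blast
  have sB: "s \<in> span B" using s(2) span_mono[of "{b \<in> B. d b = i}" B] by blast
  show ?thesis
  proof (cases "y \<in> span B")
    case True
    \<comment> \<open>No new basis vector is needed: this component stays in \<open>D\<close> by
      homogeneity and is still a preimage of \<open>s\<close>.\<close>
    let ?y = "part B d (Suc i) y"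
    have "?y \<in> D" using hom D y True by blast
    moreover have "u ?y = s"
      using u_part[OF stage True, of i] y part_homogeneous[OF ind s(2)] by simp
    moreover have "?y \<in> span B"
      using part_in_span[OF ind, of d "Suc i" y] span_mono[of "{b \<in> B. d b = Suc i}" B] by blast
    ultimately show ?thesis
      using stage D unfolding stage_extends_def by (intro exI[of _ B] exI[of _ d] exI[of _ ?y]) auto
  next
    case False
    \<comment> \<open>If a smaller \<open>E\<close> meets the coset, the degree \<open>i\<close>
      component of \<open>u (y + w)\<close> puts \<open>s + u ?w\<close> into the image of
      \<open>E\<close>. By \<open>deepest\<close> that image contains \<open>s\<close>, so
      minimality of the trace of \<open>D\<close> puts \<open>w\<close>, hence \<open>y\<close>,
      into \<open>E\<close>.\<close>
    have proper: "y \<in> E" if E: "E \<in> image_chain" and w: "w \<in> span B" and yw: "y + w \<in> E" for E w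
    proof (cases "D \<subseteq> E")
      case True then show ?thesis using y by blast
    next
      case nle: False
      then have ED: "E \<subseteq> D" using image_chain_total E D by blast
      have subE: "subspace E" using E image_chain_subspace by blast
      have "(y + w) - y \<in> D" using yw ED y subspace_diff[OF subD] by blast
      then have wD: "w \<in> D" by simp
      let ?w = "part B d (Suc i) w"
      have "u (y + w) \<in> u ` E" using yw by blast
      moreover have "u (y + w) \<in> span B"
        using sB graded_stage_invariant[OF stage w] y by (simp add: u.add span_add)
      ultimately have "part B d i (u (y + w)) \<in> u ` E"
        using hom image_chain_image[OF E] by blast
      moreover have "part B d i (u (y + w)) = s + u ?w"
      proof -
        interpret p: Vector_Spaces.linear scale scale "part B d i" by (rule linear_part[OF ind])
        show ?thesis using u_part[OF stage w, of i] part_homogeneous[OF ind s(2)] y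
          by (simp add: u.add p.add)
      qed
      ultimately have "s + u ?w \<in> u ` E" by simp
      moreover have "?w \<in> \<beta>" using hom[OF _ wD w] D by blast
      ultimately have "s \<in> u ` E" using deepest[OF E] part_in_span[OF ind] by blast
      then have "E \<inter> span B = D \<inter> span B" using Dmin E ED D by blast
      then have "w \<in> E" using w wD by blast
      then have "(y + w) - w \<in> E" using yw subspace_diff[OF subE] by blast
      then show ?thesis by simp
    qed
    have "graded_stage (insert y B) (d(y := Suc i))"
      by (rule graded_stage_insert[OF stage False]) (use s y proper in auto)
    moreover have "y \<notin> B" using False span_base by blast
    ultimately show ?thesis
      using y D span_base[of y "insert y B"] unfolding stage_extends_def
      by (intro exI[of _ "insert y B"] exI[of _ "d(y := Suc i)"] exI[of _ y]) auto
  qed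
qed

text \<open>The indices are distinct degrees, so lifting one component adds nothing to the cells on
  which the maximality hypotheses for the others depend.\<close>

lemma lift_homogeneous_family:
  assumes "finite I" "graded_stage B d" "\<beta> \<in> image_chain"
    and "\<And>i. i \<in> I \<Longrightarrow> s i \<in> u ` \<beta>" "\<And>i. i \<in> I \<Longrightarrow> s i \<in> span {b \<in> B. d b = i}"
    and "\<And>i E w. i \<in> I \<Longrightarrow> E \<in> image_chain \<Longrightarrow> w \<in> \<beta> \<Longrightarrow> w \<in> span {b \<in> B. d b = Suc i} \<Longrightarrow>
      s i + u w \<in> u ` E \<Longrightarrow> s i \<in> u ` E"
  obtains B' d' y where "graded_stage B' d'" "stage_extends B d B' d'"
    "\<And>b. b \<in> B' - B \<Longrightarrow> d' b \<in> Suc ` I" "B' \<subseteq> B \<union> y ` I"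
    "\<And>i. i \<in> I \<Longrightarrow> y i \<in> \<beta>" "\<And>i. i \<in> I \<Longrightarrow> u (y i) = s i" "\<And>i. i \<in> I \<Longrightarrow> y i \<in> span B'"
  using assms
proof (induction I arbitrary: thesis)
  case empty
  show ?case by (rule empty.prems(1)[OF empty.prems(2)]) (auto simp: stage_extends_def)
next
  case (insert j I)
  obtain B1 d1 y where 1: "graded_stage B1 d1" "stage_extends B d B1 d1"
    "\<And>b. b \<in> B1 - B \<Longrightarrow> d1 b \<in> Suc ` I" "B1 \<subseteq> B \<union> y ` I"
    "\<And>i. i \<in> I \<Longrightarrow> y i \<in> \<beta>" "\<And>i. i \<in> I \<Longrightarrow> u (y i) = s i" "\<And>i. i \<in> I \<Longrightarrow> y i \<in> span B1"
    by (rule insert.IH[OF _ insert.prems(2,3) insert.prems(4-6)[OF insertI2]];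
        (assumption | (rule that; blast)))
  have cell: "{b \<in> B1. d1 b = Suc j} = {b \<in> B. d b = Suc j}"
    using 1(2,3) insert.hyps(2) unfolding stage_extends_def by force
  have "{b \<in> B. d b = j} \<subseteq> {b \<in> B1. d1 b = j}"
    using 1(2) unfolding stage_extends_def by auto
  from span_mono[OF this] have sj: "s j \<in> span {b \<in> B1. d1 b = j}"
    using insert.prems(5) by blast
  obtain B' d' z where 2: "graded_stage B' d'" "stage_extends B1 d1 B' d'" "\<forall>b\<in>B' - B1. d' b = Suc j"
    "B' \<subseteq> insert z B1" "z \<in> \<beta>" "u z = s j" "z \<in> span B'"
    using lift_homogeneous[OF 1(1) insert.prems(3) insert.prems(4)[of j] sj] insert.prems(6)[of j]
    unfolding cell by blast
  have "span B1 \<subseteq> span B'" using 2(2) span_mono unfolding stage_extends_def by blast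
  let ?y = "y(j := z)"
  have y: "?y i \<in> \<beta>" "u (?y i) = s i" "?y i \<in> span B'" if "i \<in> insert j I" for i
    using that 1(5-7) 2(5-7) \<open>span B1 \<subseteq> span B'\<close> by (cases "i = j"; auto)+
  have "?y ` insert j I = insert z (y ` I)" using insert.hyps(2) by (auto simp: image_iff)
  then have "B' \<subseteq> B \<union> ?y ` insert j I" using 1(4) 2(4) by blast
  moreover have "stage_extends B d B' d'" using 1(2) 2(2) unfolding stage_extends_def by auto
  moreover have "d' b \<in> Suc ` insert j I" if "b \<in> B' - B" for b
    using 1(3)[of b] 2(2,3) that unfolding stage_extends_def by (cases "b \<in> B1") auto
  ultimately show ?case by (intro insert.prems(1)[OF 2(1) _ _ _ y])
qed

section \<open>Absorbing one vector into a stage\<close>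

lemma chain_common_member:
  assumes "finite I" "N \<subseteq> image_chain" "N \<noteq> {}"
    and "\<And>i. i \<in> I \<Longrightarrow> \<exists>E\<in>N. s i \<in> u ` E"
  shows "\<exists>E\<in>N. \<forall>i\<in>I. s i \<in> u ` E"
  using assms
proof (induction I)
  case (insert j I)
  then obtain E F where "E \<in> N" "\<forall>i\<in>I. s i \<in> u ` E" "F \<in> N" "s j \<in> u ` F" by fastforce
  moreover from this have "E \<subseteq> F \<or> F \<subseteq> E" using image_chain_total insert.prems(1) by blast
  ultimately show ?case by (metis image_mono insertE subsetD)
qed auto

text \<open>Since \<open>u x\<close> is already covered, the task is to choose a good representative
  of \<open>x\<close> modulo \<open>span B\<close>: first as deep as possible, then with each
  component of its image as deep as possible.\<close>

lemma absorb_invariant: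
  assumes stage: "graded_stage B d" and ux: "u x \<in> span B"
  shows "\<exists>B' d'. graded_stage B' d' \<and> stage_extends B d B' d' \<and> x \<in> span B'"
proof -
  have ind: "independent B" and fin: "finite B"
    and hom: "\<And>D v i. D \<in> image_chain \<Longrightarrow> v \<in> D \<Longrightarrow> v \<in> span B \<Longrightarrow> part B d i v \<in> D"
    using stage unfolding graded_stage_def by auto
  let ?cell = "\<lambda>i. span {b \<in> B. d b = i}"
  have cell_B: "?cell i \<subseteq> span B" for i by (rule span_mono) auto
  obtain w0 where w0: "w0 \<in> span B"
    "\<And>E w. E \<in> image_chain \<Longrightarrow> w \<in> span B \<Longrightarrow> x + w \<in> E \<Longrightarrow> x + w0 \<in> E"
    using deepest_in_image_chain[OF subspace_span order_refl fin, of x] by auto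
  define x0 where "x0 = x + w0"
  \<comment> \<open>The smallest member containing \<open>x0\<close>; by the choice of
    \<open>w0\<close>, every member meeting \<open>x0 + span B\<close> contains it.\<close>
  define \<beta> where "\<beta> = \<Inter>{D \<in> image_chain. x0 \<in> D}"
  have \<beta>: "\<beta> \<in> image_chain" unfolding \<beta>_def by (rule image_chain_Inter) blast
  have sub\<beta>: "subspace \<beta>" by (rule image_chain_subspace[OF \<beta>])
  have x0\<beta>: "x0 \<in> \<beta>" unfolding \<beta>_def by blast
  have \<beta>_le: "\<beta> \<subseteq> E" if "E \<in> image_chain" "w \<in> span B" "x0 + w \<in> E" for E w
  proof -
    have "x + (w0 + w) \<in> E" using that(3) by (simp add: x0_def add.assoc)
    then have "x0 \<in> E" using w0(2)[OF that(1) span_add[OF w0(1) that(2)]] by (simp add: x0_def)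
    then show ?thesis unfolding \<beta>_def using that(1) by blast
  qed
  have ux0: "u x0 \<in> span B"
    using ux graded_stage_invariant[OF stage w0(1)] by (simp add: x0_def u.add span_add)
  let ?s0 = "\<lambda>i. part B d i (u x0)"
  have s0: "?s0 i \<in> u ` \<beta>" for i
    using hom[OF image_chain_image[OF \<beta>] _ ux0] x0\<beta> by blast
  \<comment> \<open>In each degree a correction pushes the component of \<open>u x0\<close> as deep
    as possible; taking it inside \<open>\<beta>\<close> keeps the corrected vector in
    \<open>\<beta>\<close>.\<close>
  let ?deepest = "\<lambda>i w. w \<in> \<beta> \<inter> ?cell (Suc i) \<and> (\<forall>E\<in>image_chain. \<forall>w'\<in>\<beta> \<inter> ?cell (Suc i).
      ?s0 i + u w' \<in> u ` E \<longrightarrow> ?s0 i + u w \<in> u ` E)"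
  have "\<exists>w. ?deepest i w" for i
  proof -
    have T: "subspace (u ` (\<beta> \<inter> ?cell (Suc i)))"
      by (intro u.subspace_image subspace_inter sub\<beta> subspace_span)
    have "u ` (\<beta> \<inter> ?cell (Suc i)) \<subseteq> span B"
      using cell_B graded_stage_invariant[OF stage] by blast
    from deepest_in_image_chain[OF T this fin, of "?s0 i"]
    obtain w where w: "w \<in> \<beta> \<inter> ?cell (Suc i)"
      "\<And>E t. E \<in> image_chain \<Longrightarrow> t \<in> u ` (\<beta> \<inter> ?cell (Suc i)) \<Longrightarrow> ?s0 i + t \<in> E \<Longrightarrow> ?s0 i + u w \<in> E"
      by auto
    show ?thesis
      by (intro exI[of _ w] conjI w(1) ballI impI, erule w(2)[OF image_chain_image], rule imageI)
  qed
  then have "\<exists>w. \<forall>i. ?deepest i (w i)" by (intro choice allI)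
  then obtain w where deepest: "\<forall>i. ?deepest i (w i)" ..
  have w: "w i \<in> \<beta>" "w i \<in> ?cell (Suc i)" for i using deepest by blast+
  have w_max: "?s0 i + u (w i) \<in> u ` E"
    if "E \<in> image_chain" "w' \<in> \<beta>" "w' \<in> ?cell (Suc i)" "?s0 i + u w' \<in> u ` E" for i E w'
    using deepest[rule_format, of i] that by blast
  define I where "I = d ` B"
  define s where "s i = ?s0 i + u (w i)" for i
  define x1 where "x1 = x0 + (\<Sum>i\<in>I. w i)"
  have finI: "finite I" unfolding I_def using fin by blast
  have sum_w: "(\<Sum>i\<in>I. w i) \<in> span B" using w(2) cell_B by (intro span_sum) blast
  have x1\<beta>: "x1 \<in> \<beta>"
    unfolding x1_def using x0\<beta> w(1) sub\<beta> by (simp add: subspace_add subspace_sum)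
  have \<beta>_le1: "\<beta> \<subseteq> E" if "E \<in> image_chain" "v \<in> span B" "x1 + v \<in> E" for E v
    using \<beta>_le[OF that(1), of "(\<Sum>i\<in>I. w i) + v"] that sum_w by (simp add: x1_def add.assoc span_add)
  have ux1: "u x1 = (\<Sum>i\<in>I. s i)"
    using sum_part[OF ind fin ux0, of d]
    by (simp add: x1_def u.add u.sum s_def sum.distrib I_def)
  have s_cell: "s i \<in> ?cell i" for i
  proof -
    have "u (w i) = part B d i (u (w i))"
      using u_part[OF stage subsetD[OF cell_B w(2)], of i] part_homogeneous[OF ind w(2)] by simp
    then show ?thesis unfolding s_def using part_in_span[OF ind] by (metis span_add)
  qed
  have s_\<beta>: "s i \<in> u ` \<beta>" for i
    unfolding s_def using subspace_add[OF u.subspace_image[OF sub\<beta>] s0] w(1) by blast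
  have s_max: "s i \<in> u ` E" if E: "E \<in> image_chain" and v: "v \<in> \<beta>" "v \<in> ?cell (Suc i)"
    and sv: "s i + u v \<in> u ` E" for i E v
    using w_max[OF E, of "w i + v" i] v w sv subspace_add[OF sub\<beta>]
    by (simp add: s_def u.add span_add add.assoc)
  have x_in: "x \<in> span B'" if "span B \<subseteq> span B'" "x1 \<in> span B'" for B'
  proof -
    have "x = x1 - ((\<Sum>i\<in>I. w i) + w0)" by (simp add: x1_def x0_def)
    moreover have "(\<Sum>i\<in>I. w i) + w0 \<in> span B'" using sum_w w0(1) that(1) span_add by blast
    ultimately show ?thesis using that(2) span_diff by metis
  qed
  \<comment> \<open>If some component \<open>s j\<close> of \<open>u x1\<close> has no preimage deeper than \<open>x1\<close>, subtract preimages of all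
    other components from \<open>x1\<close> and give the result the degree \<open>Suc j\<close>. Otherwise subtract deeper
    preimages of all components; this leaves a kernel vector, which can get any degree.\<close>
  show ?thesis
  proof (cases "\<exists>j\<in>I. \<forall>E\<in>image_chain. \<not> \<beta> \<subseteq> E \<longrightarrow> s j \<notin> u ` E")
    case True
    then obtain j where j: "j \<in> I" "\<And>E. E \<in> image_chain \<Longrightarrow> \<not> \<beta> \<subseteq> E \<Longrightarrow> s j \<notin> u ` E" by blast
    obtain B' d' y where B': "graded_stage B' d'" "stage_extends B d B' d'"
      "\<And>b. b \<in> B' - B \<Longrightarrow> d' b \<in> Suc ` (I - {j})"
      and y: "\<And>i. i \<in> I - {j} \<Longrightarrow> y i \<in> \<beta>" "\<And>i. i \<in> I - {j} \<Longrightarrow> u (y i) = s i"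
        "\<And>i. i \<in> I - {j} \<Longrightarrow> y i \<in> span B'"
      by (rule lift_homogeneous_family[OF finite_Diff[OF finI, of "{j}"] stage \<beta> s_\<beta> s_cell s_max];
        (assumption | (rule that; blast)))
    have ind': "independent B'" 
      and hom': "\<And>D v i. D \<in> image_chain \<Longrightarrow> v \<in> D \<Longrightarrow> v \<in> span B' \<Longrightarrow> part B' d' i v \<in> D"
      using B'(1) unfolding graded_stage_def by auto
    define z where "z = x1 - (\<Sum>i\<in>I - {j}. y i)"
    have sum_y: "(\<Sum>i\<in>I - {j}. y i) \<in> \<beta>" "(\<Sum>i\<in>I - {j}. y i) \<in> span B'"
      by (rule subspace_sum[OF sub\<beta> y(1)] span_sum[OF y(3)]; assumption)+
    have z\<beta>: "z \<in> \<beta>" unfolding z_def using x1\<beta> sum_y(1) subspace_diff[OF sub\<beta>] by blast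
    have uz: "u z = s j"
      using y(2) ux1 j(1) finI by (simp add: z_def u.diff u.sum sum.remove[of I j])
    have BB': "span B \<subseteq> span B'" using B'(2) span_mono unfolding stage_extends_def by blast
    \<comment> \<open>Omitting \<open>j\<close> leaves the cell of degree \<open>Suc j\<close>
      unchanged, so \<open>s_max\<close> for \<open>j\<close> still applies in the larger
      stage.\<close>
    have cell: "{b \<in> B'. d' b = Suc j} = {b \<in> B. d b = Suc j}"
      using B'(2,3) unfolding stage_extends_def by force
    have "{b \<in> B. d b = j} \<subseteq> {b \<in> B'. d' b = j}"
      using B'(2) unfolding stage_extends_def by auto
    from span_mono[OF this] have sj: "s j \<in> span {b \<in> B'. d' b = j}"
      using s_cell by blast
    show ?thesis
    proof (cases "z \<in> span B'")
      case True
      then have "x1 \<in> span B'" using sum_y(2) span_add[of z B'] unfolding z_def by fastforce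
      then show ?thesis using B' x_in[OF BB'] by blast
    next
      case False
      \<comment> \<open>If \<open>E\<close> met the coset without containing \<open>z\<close>, the
        degree \<open>j\<close> component of \<open>u (z + v)\<close> would, by
        \<open>s_max\<close>, put \<open>s j\<close> into the image of \<open>E\<close>, against the
        choice of \<open>j\<close>.\<close>
      have "z \<in> E" if E: "E \<in> image_chain" and v: "v \<in> span B'" and zv: "z + v \<in> E" for E v
      proof (rule ccontr)
        assume "z \<notin> E"
        then have nle: "\<not> \<beta> \<subseteq> E" using z\<beta> by blast
        then have "E \<subseteq> \<beta>" using image_chain_total E \<beta> by blast
        then have "(z + v) - z \<in> \<beta>" using zv z\<beta> subspace_diff[OF sub\<beta>] by blast
        then have "part B' d' (Suc j) v \<in> \<beta>" using hom'[OF \<beta> _ v] by simp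
        moreover have "part B' d' (Suc j) v \<in> ?cell (Suc j)"
          using part_in_span[OF ind', of d' "Suc j" v] unfolding cell .
        moreover have "s j + u (part B' d' (Suc j) v) \<in> u ` E"
        proof -
          interpret p: Vector_Spaces.linear scale scale "part B' d' j" by (rule linear_part[OF ind'])
          have "u (z + v) \<in> span B'"
            using graded_stage_invariant[OF B'(1) v] s_cell cell_B BB' by (auto simp: u.add uz intro!: span_add)
          then have "part B' d' j (u (z + v)) \<in> u ` E"
            using hom'[OF image_chain_image[OF E]] zv by blast
          then show ?thesis
            using u_part[OF B'(1) v, of j] part_homogeneous[OF ind' sj] by (simp add: u.add p.add uz)
        qed
        ultimately have "s j \<in> u ` E" using s_max[OF E] by blast
        then show False using j(2)[OF E nle] by blast
      qed
      then have "graded_stage (insert z B') (d'(z := Suc j))"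
        using graded_stage_insert[OF B'(1) False, of "Suc j"] uz sj by auto
      moreover have "stage_extends B d (insert z B') (d'(z := Suc j))"
        using B'(2) False span_base[of z B'] unfolding stage_extends_def by auto
      moreover have "span B' \<subseteq> span (insert z B')" by (rule span_mono) blast
      moreover from this have "x1 \<in> span (insert z B')"
        using sum_y(2) span_add[of z "insert z B'" "\<Sum>i\<in>I - {j}. y i"] span_base[of z "insert z B'"]
        unfolding z_def by auto
      ultimately show ?thesis using x_in[of "insert z B'"] BB' by blast
    qed
  next
    case False
    let ?N = "{E \<in> image_chain. \<not> \<beta> \<subseteq> E}"
    \<comment> \<open>One \<open>D\<close> strictly below \<open>\<beta>\<close> serves all
      components, as they are finitely many and the chain is total. If there are none,
      \<open>\<beta>\<close> itself is taken, since nothing strictly smaller need exist.\<close>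
    have "\<exists>D\<in>image_chain. D \<subseteq> \<beta> \<and> (\<forall>i\<in>I. s i \<in> u ` D) \<and> (I = {} \<or> \<not> \<beta> \<subseteq> D)"
    proof (cases "I = {}")
      case True then show ?thesis using \<beta> by blast
    next
      case ne: False
      then have "?N \<noteq> {}" using False by blast
      then obtain D where "D \<in> ?N" "\<forall>i\<in>I. s i \<in> u ` D"
        using chain_common_member[of I ?N s] finI False by blast
      then show ?thesis using image_chain_total \<beta> by blast
    qed
    then obtain D where D: "D \<in> image_chain" "D \<subseteq> \<beta>" "\<And>i. i \<in> I \<Longrightarrow> s i \<in> u ` D" "I = {} \<or> \<not> \<beta> \<subseteq> D"
      by blast
    have subD: "subspace D" by (rule image_chain_subspace[OF D(1)])
    obtain B' d' y where B': "graded_stage B' d'" "stage_extends B d B' d'" "B' \<subseteq> B \<union> y ` I"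
      and y: "\<And>i. i \<in> I \<Longrightarrow> y i \<in> D" "\<And>i. i \<in> I \<Longrightarrow> u (y i) = s i" "\<And>i. i \<in> I \<Longrightarrow> y i \<in> span B'"
      by (rule lift_homogeneous_family[OF finI stage D(1) D(3) s_cell s_max[OF _ subsetD[OF D(2)]]];
        (assumption | (rule that; blast)))
    define k where "k = x1 - (\<Sum>i\<in>I. y i)"
    have sum_y: "(\<Sum>i\<in>I. y i) \<in> D" "(\<Sum>i\<in>I. y i) \<in> span B'"
      by (rule subspace_sum[OF subD y(1)] span_sum[OF y(3)]; assumption)+
    have k\<beta>: "k \<in> \<beta>" unfolding k_def using x1\<beta> sum_y(1) D(2) subspace_diff[OF sub\<beta>] by blast
    have uk: "u k = 0" using y(2) ux1 by (simp add: k_def u.diff u.sum)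
    have BB': "span B \<subseteq> span B'" using B'(2) span_mono unfolding stage_extends_def by blast
    show ?thesis
    proof (cases "k \<in> span B'")
      case True
      then have "x1 \<in> span B'" using sum_y(2) span_add[of k B'] unfolding k_def by fastforce
      then show ?thesis using B' x_in[OF BB'] by blast
    next
      case False
      have "k \<in> E" if E: "E \<in> image_chain" and v: "v \<in> span B'" and kv: "k + v \<in> E" for E v
      proof -
        have subE: "subspace E" by (rule image_chain_subspace[OF E])
        \<comment> \<open>Modulo \<open>D\<close>, \<open>k + v\<close> agrees with
          \<open>x1 + v1\<close>, so the larger of \<open>D\<close> and \<open>E\<close> contains
          \<open>x1 + v1\<close> and hence \<open>\<beta>\<close>. As \<open>D\<close> lies strictly
          below \<open>\<beta>\<close>, that one is \<open>E\<close>. For empty \<open>I\<close>,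
          \<open>k = x1\<close>.\<close>
        have "v \<in> span (B \<union> y ` I)" using v span_mono[OF B'(3)] by blast
        then obtain v1 v2 where v12: "v = v1 + v2" "v1 \<in> span B" "v2 \<in> span (y ` I)"
          unfolding span_Un by blast
        have "span (y ` I) \<subseteq> D" using y(1) subD by (intro span_minimal) auto
        then have t: "v2 - (\<Sum>i\<in>I. y i) \<in> D" using v12(3) sum_y(1) subspace_diff[OF subD] by blast
        have eq: "k + v = (x1 + v1) + (v2 - (\<Sum>i\<in>I. y i))" by (simp add: k_def v12(1))
        have "\<beta> \<subseteq> E"
        proof (cases "D \<subseteq> E")
          case True
          then have "(k + v) - (v2 - (\<Sum>i\<in>I. y i)) \<in> E" using t kv subspace_diff[OF subE] by blast
          then show ?thesis using \<beta>_le1[OF E v12(2)] by (simp add: eq)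
        next
          case nle: False
          then have ED: "E \<subseteq> D" using image_chain_total E D(1) by blast
          show ?thesis
          proof (cases "I = {}")
            case True
            then have "x1 + v \<in> E" "v \<in> span B" using kv v span_mono[OF B'(3)] by (auto simp: k_def)
            then show ?thesis using \<beta>_le1[OF E] by blast
          next
            case ne: False
            have "(k + v) - (v2 - (\<Sum>i\<in>I. y i)) \<in> D" using t kv ED subspace_diff[OF subD] by blast
            then have "\<beta> \<subseteq> D" using \<beta>_le1[OF D(1) v12(2)] by (simp add: eq)
            then show ?thesis using D(4) ne by blast
          qed
        qed
        then show ?thesis using k\<beta> by blast
      qed
      then have "graded_stage (insert k B') (d'(k := 0))"
        using graded_stage_insert[OF B'(1) False, of 0] uk by (simp add: span_zero)
      moreover have "stage_extends B d (insert k B') (d'(k := 0))"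
        using B'(2) False span_base[of k B'] unfolding stage_extends_def by auto
      moreover have "span B' \<subseteq> span (insert k B')" by (rule span_mono) blast
      moreover from this have "x1 \<in> span (insert k B')"
        using sum_y(2) span_add[of k "insert k B'" "\<Sum>i\<in>I. y i"] span_base[of k "insert k B'"]
        unfolding k_def by auto
      ultimately show ?thesis using x_in[of "insert k B'"] BB' by blast
    qed
  qed
qed

text \<open>Induction on the exponent killing \<open>x\<close>: once \<open>u x\<close> is absorbed,
  \<open>absorb_invariant\<close> applies to \<open>x\<close>.\<close>

lemma absorb:
  assumes "graded_stage B d"
  shows "\<exists>B' d'. graded_stage B' d' \<and> stage_extends B d B' d' \<and> x \<in> span B'"
proof -
  obtain n where "(u ^^ n) x = 0" using nilpotent by blast
  then show ?thesis
  proof (induction n arbitrary: x)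
    case 0
    then show ?case using assms span_zero unfolding stage_extends_def by auto
  next
    case (Suc n)
    obtain B1 d1 where 1: "graded_stage B1 d1" "stage_extends B d B1 d1" "u x \<in> span B1"
      using Suc.IH[of "u x"] Suc.prems by (auto simp: funpow_swap1)
    obtain B' d' where "graded_stage B' d'" "stage_extends B1 d1 B' d'" "x \<in> span B'"
      using absorb_invariant[OF 1(1,3)] by blast
    then show ?case using 1(2) unfolding stage_extends_def by (intro exI[of _ B'] exI[of _ d']) auto
  qed
qed

text \<open>The countable spanning set is enumerated and absorbed one vector at a time. The union of
  the increasing stages is the basis; degrees, once assigned, never change.\<close>

lemma graded_basis:
  assumes "countable C" "span C = UNIV"
  obtains B d where "independent B" "span B = UNIV"
    "\<And>b. b \<in> B \<Longrightarrow> u b \<in> span {b' \<in> B. Suc (d b') = d b}"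
proof -
  obtain e :: "nat \<Rightarrow> 'v" where e: "C \<subseteq> range e"
    using assms(1) by (metis empty_subsetI range_from_nat_into subset_refl)
  have "\<exists>f. \<forall>n. graded_stage (fst (f n)) (snd (f n)) \<and>
      (stage_extends (fst (f n)) (snd (f n)) (fst (f (Suc n))) (snd (f (Suc n))) \<and> e n \<in> span (fst (f (Suc n))))"
  proof (rule dependent_nat_choice[where P="\<lambda>_ S. graded_stage (fst S) (snd S)"])
    have "graded_stage {} (\<lambda>_. 0)"
      unfolding graded_stage_def part_def endo.construct_def
      by (simp add: subspace_0 image_chain_subspace independent_empty)
    then show "\<exists>S. graded_stage (fst S) (snd S)" by force
  next
    fix S :: "'v set \<times> ('v \<Rightarrow> nat)" and n
    assume "graded_stage (fst S) (snd S)"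
    from absorb[OF this, of "e n"] show "\<exists>S'. graded_stage (fst S') (snd S') \<and>
        stage_extends (fst S) (snd S) (fst S') (snd S') \<and> e n \<in> span (fst S')"
      by auto
  qed
  then obtain f where f: "\<And>n. graded_stage (fst (f n)) (snd (f n))"
    "\<And>n. stage_extends (fst (f n)) (snd (f n)) (fst (f (Suc n))) (snd (f (Suc n)))"
    "\<And>n. e n \<in> span (fst (f (Suc n)))" by blast
  define A where "A n = fst (f n)" for n
  define D where "D n = snd (f n)" for n
  have mono: "A m \<subseteq> A n \<and> (\<forall>b\<in>A m. D n b = D m b)" if "m \<le> n" for m n
    using that
  proof (induction n rule: dec_induct)
    case (step n)
    then show ?case using f(2)[of n] unfolding stage_extends_def A_def D_def by auto
  qed simp
  define d where "d b = D (LEAST n. b \<in> A n) b" for b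
  have d: "d b = D n b" if "b \<in> A n" for b n
    unfolding d_def using mono[OF Least_le[of "\<lambda>n. b \<in> A n", OF that]] LeastI[of "\<lambda>n. b \<in> A n", OF that]
    by auto
  have lin: "independent (A n)" "\<And>b. b \<in> A n \<Longrightarrow> u b \<in> span {b' \<in> A n. Suc (D n b') = D n b}" for n
    using f(1)[of n] unfolding graded_stage_def A_def D_def by auto
  show thesis
  proof (rule that[of "\<Union>n. A n" d])
    show "independent (\<Union>n. A n)"
    proof (rule independent_Union_directed)
      show "c \<subseteq> c' \<or> c' \<subseteq> c" if "c \<in> range A" "c' \<in> range A" for c c'
        using that mono nat_le_linear by (metis imageE)
    qed (use lin in auto)
    have "e n \<in> span (\<Union>n. A n)" for n
      using f(3)[of n] span_mono[of "A (Suc n)" "\<Union>n. A n"] unfolding A_def by blast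
    then have "span C \<subseteq> span (\<Union>n. A n)" using e by (intro span_minimal) auto
    then show "span (\<Union>n. A n) = UNIV" using assms(2) by blast
    fix b assume "b \<in> (\<Union>n. A n)"
    then obtain n where n: "b \<in> A n" by blast
    have "{b' \<in> A n. Suc (D n b') = D n b} \<subseteq> {b' \<in> \<Union>n. A n. Suc (d b') = d b}"
      using d n by auto
    then show "u b \<in> span {b' \<in> \<Union>n. A n. Suc (d b') = d b}"
      using lin(2)[OF n] span_mono by blast
  qed
qed

section \<open>The factorizations\<close>

text \<open>On the kernel \<open>u x = - x\<close>, so iterates of \<open>u\<close> only change the
  sign of \<open>x\<close>, and nilpotency gives \<open>x = 0\<close>. For surjectivity, a preimage
  \<open>y\<close> of \<open>u x\<close> yields the preimage \<open>x - y\<close> of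
  \<open>x\<close>. This is used for \<open>u\<close> and later for
  \<open>\<phi> - id\<close>.\<close>

lemma bij_id_plus: "bij (\<lambda>x. x + u x)"
proof -
  have "x = 0" if "x + u x = 0" for x
  proof -
    have *: "u x = - x" using that by (simp add: eq_neg_iff_add_eq_0 add.commute)
    have "(u ^^ n) x = x \<or> (u ^^ n) x = - x" for n
      by (induction n) (auto simp: * u.neg)
    then show ?thesis using nilpotent[of x] by (metis neg_equal_0_iff_equal)
  qed
  moreover have "x + u x - (y + u y) = (x - y) + u (x - y)" for x y
    by (simp add: u.diff)
  ultimately have "inj (\<lambda>x. x + u x)"
    unfolding inj_def by (metis eq_iff_diff_eq_0)
  moreover have "x \<in> range (\<lambda>x. x + u x)" for x
  proof -
    obtain n where "(u ^^ n) x = 0" using nilpotent by blast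
    then show ?thesis
    proof (induction n arbitrary: x)
      case 0
      then show ?case using u.zero by (intro image_eqI[of _ _ 0]) auto
    next
      case (Suc n)
      then obtain y where "u x = y + u y" by (auto simp: funpow_swap1)
      then have "x = (x - y) + u (x - y)" by (simp add: u.diff)
      then show ?case by blast
    qed
  qed
  ultimately show ?thesis unfolding bij_def by blast
qed

lemma linear_comp:
  assumes "endomorphism scale f" "endomorphism scale h"
  shows "endomorphism scale (h \<circ> f)"
  using assms by (rule Vector_Spaces.linear_compose)

definition id_plus :: "'v \<Rightarrow> 'v" where "id_plus x = x + u x"

lemma linear_id_plus: "endomorphism scale id_plus"
  unfolding id_plus_def[abs_def] by (intro endo.linear_compose_add linear_ident u.linear_axioms)

lemma linear_id_plus_power: "endomorphism scale (id_plus ^^ n)"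
proof (induction n)
  case 0
  then show ?case using linear_id by (simp add: id_def)
next
  case (Suc n)
  then show ?case unfolding funpow.simps using linear_id_plus by (rule linear_comp)
qed

lemma inj_id_plus_power: "inj (id_plus ^^ n)"
  using bij_id_plus by (intro inj_fn) (simp add: id_plus_def[abs_def] bij_def)

end

section \<open>The two factorizations over a graded basis\<close>

locale graded_endomorphism = locally_nilpotent_endomorphism +
  fixes B :: "'b set" and d :: "'b \<Rightarrow> nat"
  assumes independent: "independent B" and spanning: "span B = UNIV"
    and graded: "\<And>b. b \<in> B \<Longrightarrow> u b \<in> span {b' \<in> B. Suc (d b') = d b}"
begin

lemma linear_eq_basis:
  assumes "endomorphism scale f" "endomorphism scale h"
    and "\<And>b. b \<in> B \<Longrightarrow> f b = h b"
  shows "f = h"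
proof
  fix x show "f x = h x"
    by (rule endo.linear_eq_on[OF assms(1,2), of x B]) (simp_all add: spanning assms(3))
qed

text \<open>If an involution \<open>a\<close> conjugates \<open>id_plus\<close> to its inverse, then
  \<open>a \<circ> id_plus\<close> is an involution too, and \<open>id_plus\<close> is the product
  of the two.\<close>

lemma involution_product:
  "\<exists>a b. involution scale a \<and> involution scale b \<and> id_plus = a \<circ> b"
proof -
  \<comment> \<open>A vector of degree \<open>n\<close> models \<open>t\<^sup>-\<^sup>n\<close>,
    which the substitution sends to
    \<open>(-1)\<^sup>n (1 + t)\<^sup>n t\<^sup>-\<^sup>n\<close>.\<close>
  define a where "a = endo.construct B (\<lambda>b. scale ((-1) ^ d b) ((id_plus ^^ d b) b))"
  interpret a: Vector_Spaces.linear scale scale a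
    unfolding a_def by (rule endo.linear_construct[OF independent])
  interpret id_plus: Vector_Spaces.linear scale scale id_plus by (rule linear_id_plus)
  interpret gn: Vector_Spaces.linear scale scale "id_plus ^^ n" for n by (rule linear_id_plus_power)
  have a_basis: "a b = scale ((-1) ^ d b) ((id_plus ^^ d b) b)" if "b \<in> B" for b
    unfolding a_def by (rule endo.construct_basis[OF independent that])
  have lin: "endomorphism scale (\<lambda>v. scale c ((id_plus ^^ n) v))" for n c
    by (intro endo.linear_compose_scale_right linear_id_plus_power)
  have a_cell: "a v = scale ((-1) ^ n) ((id_plus ^^ n) v)" if "v \<in> span {b \<in> B. Suc (d b) = Suc n}" for v n
    by (rule endo.linear_eq_on[OF a.linear_axioms lin that]) (auto simp: a_basis)
  \<comment> \<open>Conjugation of \<open>id_plus\<close> to its inverse, in a form free of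
    inverses.\<close>
  have "(id_plus \<circ> a \<circ> id_plus) = a"
  proof (rule linear_eq_basis)
    show "endomorphism scale (id_plus \<circ> a \<circ> id_plus)"
      by (intro linear_comp linear_id_plus a.linear_axioms)
    fix b assume b: "b \<in> B"
    show "(id_plus \<circ> a \<circ> id_plus) b = a b"
    proof (cases "d b")
      case 0
      then have "u b = 0" using graded[OF b] by simp
      then show ?thesis by (simp add: id_plus_def a_basis[OF b] 0)
    next
      case (Suc n)
      have "a (u b) = scale ((-1) ^ n) ((id_plus ^^ n) (u b))"
        using a_cell graded[OF b] Suc by simp
      then have "a (id_plus b) = scale ((-1) ^ n) ((id_plus ^^ n) (u b)) - scale ((-1) ^ n) ((id_plus ^^ n) (id_plus b))"
        by (simp add: id_plus_def[of b] a.add a_basis[OF b] Suc funpow_swap1)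
      also have "\<dots> = scale ((-1) ^ n) ((id_plus ^^ n) (u b - id_plus b))"
        by (simp add: gn.diff scale_right_diff_distrib)
      also have "\<dots> = scale ((-1) ^ Suc n) ((id_plus ^^ n) b)"
        by (simp add: id_plus_def gn.neg)
      finally show ?thesis by (simp add: id_plus.neg id_plus.scale a_basis[OF b] Suc)
    qed
  qed (rule a.linear_axioms)
  then have gag: "id_plus (a (id_plus x)) = a x" for x by (metis comp_apply)
  have gnagn: "(id_plus ^^ n) (a ((id_plus ^^ n) x)) = a x" for n x
    by (induction n arbitrary: x) (simp_all add: funpow_swap1 gag)
  have "a \<circ> a = id"
  proof (rule linear_eq_basis)
    show "endomorphism scale (a \<circ> a)"
      by (intro linear_comp a.linear_axioms)
    fix b assume b: "b \<in> B"
    let ?n = "d b"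
    \<comment> \<open>With the extra injective power in front, \<open>gnagn\<close> absorbs both
      powers; it is cancelled at the end.\<close>
    have "(id_plus ^^ ?n) (a (a b)) = scale ((-1) ^ ?n) ((id_plus ^^ ?n) (a ((id_plus ^^ ?n) b)))"
      by (simp add: a_basis[OF b] a.scale gn.scale)
    also have "\<dots> = (id_plus ^^ ?n) b"
      by (simp add: gnagn a_basis[OF b] flip: power_mult_distrib)
    finally show "(a \<circ> a) b = id b" using inj_id_plus_power by (simp add: inj_eq)
  qed (rule linear_id)
  then have aa: "a (a x) = x" for x by (metis comp_apply id_apply)
  have "involution scale a"
    unfolding involution_def using a.linear_axioms by (auto simp: numeral_2_eq_2 aa)
  moreover have "involution scale (a \<circ> id_plus)"
    unfolding involution_def using linear_comp[OF linear_id_plus a.linear_axioms]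
    by (auto simp: numeral_2_eq_2 aa gag)
  moreover have "id_plus = a \<circ> (a \<circ> id_plus)" by (auto simp: aa)
  ultimately show ?thesis by blast
qed

text \<open>Since \<open>u\<close> switches the parity of the degree, its restrictions
  \<open>p\<close> and \<open>q\<close> to even and odd degrees have square zero. The map
  \<open>\<phi>\<close> intertwines \<open>id_plus\<close> with
  \<open>(id + p) \<circ> (id + q)\<close>; being bijective, it carries these factors to factors of
  \<open>id_plus\<close>.\<close>

lemma unipotent_product:
  "\<exists>a b. unipotent_index_2 scale a \<and> unipotent_index_2 scale b \<and> id_plus = a \<circ> b"
proof -
  \<comment> \<open>In the Jordan block model, \<open>\<phi>\<close> maps \<open>t\<^sup>-\<^sup>2\<^sup>m\<close> to \<open>s\<^sup>-\<^sup>m\<close> and \<open>t\<^sup>1\<^sup>-\<^sup>2\<^sup>m\<close> to \<open>t s\<^sup>-\<^sup>m\<close>.\<close>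
  define \<phi> where "\<phi> = endo.construct B (\<lambda>b. (id_plus ^^ (Suc (d b) div 2)) b)"
  define p where "p = endo.construct B (\<lambda>b. if even (d b) then u b else 0)"
  define q where "q = endo.construct B (\<lambda>b. if odd (d b) then u b else 0)"
  interpret \<phi>: Vector_Spaces.linear scale scale \<phi>
    unfolding \<phi>_def by (rule endo.linear_construct[OF independent])
  interpret p: Vector_Spaces.linear scale scale p
    unfolding p_def by (rule endo.linear_construct[OF independent])
  interpret q: Vector_Spaces.linear scale scale q
    unfolding q_def by (rule endo.linear_construct[OF independent])
  interpret id_plus: Vector_Spaces.linear scale scale id_plus by (rule linear_id_plus)
  interpret gn: Vector_Spaces.linear scale scale "id_plus ^^ n" for n by (rule linear_id_plus_power)
  note basis = endo.construct_basis[OF independent]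
  have \<phi>_basis: "\<phi> b = (id_plus ^^ (Suc (d b) div 2)) b"
    and p_basis: "p b = (if even (d b) then u b else 0)"
    and q_basis: "q b = (if odd (d b) then u b else 0)" if "b \<in> B" for b
    unfolding \<phi>_def p_def q_def by (simp_all add: basis that)
  \<comment> \<open>Here \<open>n\<close> is the degree plus one: \<open>n div 2\<close> is the
    exponent in \<open>\<phi>\<close>, and \<open>even n\<close> in \<open>p_cell\<close> and
    \<open>q_cell\<close> means odd degree.\<close>
  have \<phi>_cell: "\<phi> v = (id_plus ^^ (n div 2)) v" if "v \<in> span {b \<in> B. Suc (d b) = n}" for v n
    by (rule endo.linear_eq_on[OF \<phi>.linear_axioms linear_id_plus_power that]) (auto simp: \<phi>_basis)
  have p_cell: "p v = (if even n then 0 else u v)" if "v \<in> span {b \<in> B. Suc (d b) = n}" for v n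
  proof -
    have "p v = (if even n then (\<lambda>_. 0) else u) v"
      by (rule endo.linear_eq_on[OF p.linear_axioms _ that])
        (auto simp: p_basis endo.linear_zero u.linear_axioms)
    then show ?thesis by simp
  qed
  have q_cell: "q v = (if even n then u v else 0)" if "v \<in> span {b \<in> B. Suc (d b) = n}" for v n
  proof -
    have "q v = (if even n then u else (\<lambda>_. 0)) v"
      by (rule endo.linear_eq_on[OF q.linear_axioms _ that])
        (auto simp: q_basis endo.linear_zero u.linear_axioms)
    then show ?thesis by simp
  qed
  have "p \<circ> p = (\<lambda>x. 0)"
    by (rule linear_eq_basis)
      (auto simp: p_basis p_cell[OF graded] endo.linear_zero p.linear_axioms
        intro!: linear_comp)
  then have pp: "p (p x) = 0" for x by (metis comp_apply)
  have "q \<circ> q = (\<lambda>x. 0)"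
    by (rule linear_eq_basis)
      (auto simp: q_basis q_cell[OF graded] endo.linear_zero q.linear_axioms
        intro!: linear_comp)
  then have qq: "q (q x) = 0" for x by (metis comp_apply)
  have "id_plus \<circ> \<phi> = \<phi> \<circ> ((\<lambda>x. x + p x) \<circ> (\<lambda>x. x + q x))"
  proof (rule linear_eq_basis)
    show "endomorphism scale (id_plus \<circ> \<phi>)"
      "endomorphism scale (\<phi> \<circ> ((\<lambda>x. x + p x) \<circ> (\<lambda>x. x + q x)))"
      by (intro linear_comp endo.linear_compose_add linear_ident linear_id_plus
          \<phi>.linear_axioms p.linear_axioms q.linear_axioms)+
    fix b assume b: "b \<in> B"
    show "(id_plus \<circ> \<phi>) b = (\<phi> \<circ> ((\<lambda>x. x + p x) \<circ> (\<lambda>x. x + q x))) b"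
    proof (cases "even (d b)")
      case True
      then have "\<phi> (b + u b) = (id_plus ^^ (d b div 2)) (id_plus b)"
        using \<phi>_cell[OF graded[OF b]] by (simp add: \<phi>.add \<phi>_basis[OF b] gn.add id_plus_def)
      then show ?thesis
        using True by (simp add: p_basis q_basis b \<phi>_basis funpow_swap1)
    next
      case False
      then obtain m where m: "d b = Suc (2 * m)" by (metis oddE Suc_eq_plus1)
      \<comment> \<open>For \<open>m = 0\<close> the target is the span of the empty set, so the
        argument also shows \<open>u (u b) = 0\<close> in degree 1.\<close>
      have "u (u b) \<in> u ` span {b' \<in> B. Suc (d b') = d b}" using graded[OF b] by blast
      also have "\<dots> \<subseteq> span {b' \<in> B. Suc (d b') = 2 * m}"
        unfolding u.span_image[symmetric]
      proof (rule span_minimal[OF _ subspace_span], clarify)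
        fix b' assume "b' \<in> B" "Suc (d b') = d b"
        then show "u b' \<in> span {b' \<in> B. Suc (d b') = 2 * m}" using graded[of b'] m by simp
      qed
      finally have "\<phi> (u (u b)) = (id_plus ^^ m) (u (u b))"
        using \<phi>_cell[of "u (u b)" "2 * m"] by simp
      moreover have "\<phi> (u b) = (id_plus ^^ m) (u b)"
        using \<phi>_cell[OF graded[OF b]] m by simp
      moreover have "\<phi> b = (id_plus ^^ m) (id_plus b)"
        by (simp add: \<phi>_basis[OF b] m funpow_swap1)
      moreover have "id_plus b + u b + u (u b) = id_plus (id_plus b)"
        by (simp add: id_plus_def u.add)
      ultimately show ?thesis
        using m p_cell[OF graded[OF b]]
        by (simp add: p_basis q_basis b p.add \<phi>.add add.assoc funpow_swap1 flip: gn.add)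
    qed
  qed
  then have id_plus\<phi>: "id_plus (\<phi> x) = \<phi> (x + q x + p (x + q x))" for x
    by (metis (no_types, lifting) comp_apply)
  \<comment> \<open>This difference strictly lowers the filtration by degree, so it is locally
    nilpotent, and \<open>bij_id_plus\<close> makes \<open>\<phi>\<close> bijective.\<close>
  define n where "n x = \<phi> x - x" for x
  let ?below = "\<lambda>k. {b \<in> B. d b < k}"
  interpret n: Vector_Spaces.linear scale scale n
    unfolding n_def[abs_def] by (intro endo.linear_compose_sub linear_ident \<phi>.linear_axioms)
  have "u ` span (?below (Suc k)) \<subseteq> span (?below k)" for k
    unfolding u.span_image[symmetric]
  proof (rule span_minimal[OF _ subspace_span], clarify)
    fix b assume b: "b \<in> B" "d b < Suc k"
    then have "{b' \<in> B. Suc (d b') = d b} \<subseteq> ?below k" by auto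
    then show "u b \<in> span (?below k)" using graded[OF b(1)] span_mono by blast
  qed
  moreover have below_mono: "span (?below k) \<subseteq> span (?below (Suc k))" for k
    by (rule span_mono) auto
  ultimately have u_below: "u v \<in> span (?below k)" if "v \<in> span (?below (Suc k))" for k v
    using that by blast
  have id_plus_below: "(id_plus ^^ m) v - v \<in> span (?below k)" if v: "v \<in> span (?below (Suc k))" for k m v
  proof (induction m)
    case 0
    show ?case by (simp add: span_zero)
  next
    case (Suc m)
    have "(id_plus ^^ m) v = ((id_plus ^^ m) v - v) + v" by simp
    then have "(id_plus ^^ m) v \<in> span (?below (Suc k))"
      using Suc below_mono v span_add by (metis subsetD)
    then have "((id_plus ^^ m) v - v) + u ((id_plus ^^ m) v) \<in> span (?below k)"
      using u_below Suc span_add by blast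
    then show ?case by (simp add: id_plus_def[of "(id_plus ^^ m) v"] algebra_simps)
  qed
  have "n ` span (?below (Suc k)) \<subseteq> span (?below k)" for k
    unfolding n.span_image[symmetric]
  proof (rule span_minimal[OF _ subspace_span], clarify)
    fix b assume "b \<in> B" "d b < Suc k"
    then show "n b \<in> span (?below k)"
      using id_plus_below[of b k] span_base[of b "?below (Suc k)"] by (simp add: n_def \<phi>_basis)
  qed
  then have "(n ^^ k) v = 0" if "v \<in> span (?below k)" for k v
    using that by (induction k arbitrary: v) (auto simp: funpow_swap1 image_subset_iff)
  moreover have "\<exists>k. v \<in> span (?below k)" for v
  proof -
    \<comment> \<open>Each vector is a finite combination of basis vectors, so its degrees are
      bounded.\<close>
    have "v \<in> span B" by (simp add: spanning)
    then obtain F where F: "finite F" "F \<subseteq> B" "v \<in> span F"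
      unfolding span_explicit using span_explicit by (smt (verit) mem_Collect_eq span_base span_scale span_sum)
    have "d b < Suc (Max (d ` F))" if "b \<in> F" for b
      using that F(1) by (simp add: le_imp_less_Suc)
    then have "F \<subseteq> ?below (Suc (Max (d ` F)))" using F(2) by blast
    then show ?thesis using F(3) span_mono by blast
  qed
  ultimately interpret n: locally_nilpotent_endomorphism scale n
    by unfold_locales blast
  have "bij \<phi>" using n.bij_id_plus by (simp add: n_def)
  then obtain \<psi> where \<psi>: "endomorphism scale \<psi>" "\<psi> \<circ> \<phi> = id" "\<phi> \<circ> \<psi> = id"
    using endo.linear_injective_left_inverse[OF \<phi>.linear_axioms] 
    by (metis bij_def left_right_inverse_eq surj_iff)
  then have \<psi>\<phi>: "\<psi> (\<phi> x) = x" and \<phi>\<psi>: "\<phi> (\<psi> x) = x" for x by (metis comp_apply id_apply)+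
  have unipotent: "unipotent_index_2 scale (\<lambda>x. x + \<phi> (r (\<psi> x)))"
    if "endomorphism scale r" "\<And>x. r (r x) = 0" for r
  proof -
    have "endomorphism scale (\<phi> \<circ> (r \<circ> \<psi>))"
      by (intro linear_comp \<phi>.linear_axioms that(1) \<psi>(1))
    from endo.linear_compose_add[OF linear_ident this] show ?thesis
      unfolding unipotent_index_2_def by (auto simp: numeral_2_eq_2 \<psi>\<phi> that(2))
  qed
  have "id_plus x = x + \<phi> (q (\<psi> x)) + \<phi> (p (\<psi> (x + \<phi> (q (\<psi> x)))))" for x
  proof -
    interpret \<psi>: Vector_Spaces.linear scale scale \<psi> by (rule \<psi>(1))
    show ?thesis using id_plus\<phi>[of "\<psi> x"] by (simp add: \<psi>\<phi> \<phi>\<psi> \<psi>.add \<phi>.add)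
  qed
  then have "id_plus = (\<lambda>x. x + \<phi> (p (\<psi> x))) \<circ> (\<lambda>x. x + \<phi> (q (\<psi> x)))" by auto
  then show ?thesis
    using unipotent[OF p.linear_axioms pp] unipotent[OF q.linear_axioms qq] by blast
qed

end

theorem theorem1p7:
  fixes scale :: "'f::field \<Rightarrow> 'v::ab_group_add \<Rightarrow> 'v"
    and u :: "'v \<Rightarrow> 'v"
  assumes "vector_space scale"
    and "countable_dimension scale"
    and "endomorphism scale u"
    and "locally_nilpotent u"
  shows "(\<exists>a b. involution scale a \<and> involution scale b \<and> (\<lambda>x. id x + u x) = a \<circ> b)
       \<and> (\<exists>a b. unipotent_index_2 scale a \<and> unipotent_index_2 scale b \<and> (\<lambda>x. id x + u x) = a \<circ> b)"
proof -
  interpret locally_nilpotent_endomorphism scale u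
    using assms(1,3,4)
    by (intro locally_nilpotent_endomorphism.intro locally_nilpotent_endomorphism_axioms.intro)
      (auto simp: locally_nilpotent_def)
  obtain C where "countable C" "span C = UNIV"
    using assms(2) unfolding countable_dimension_def by blast
  then obtain B d where "independent B" "span B = UNIV"
    "\<And>b. b \<in> B \<Longrightarrow> u b \<in> span {b' \<in> B. Suc (d b') = d b}"
    using graded_basis by blast
  then interpret graded_endomorphism scale u B d
    by unfold_locales
  have "id_plus = (\<lambda>x. id x + u x)" by (auto simp: id_plus_def)
  then show ?thesis using involution_product unipotent_product by simp
qed

end
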